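(* Let $R$ be a finite commutative local principal ring. Denote by $\operatorname{IN}(M_2(R))$ and $\operatorname{NI}(M_2(R))$ the sets of all IN-matrices and all NI-matrices in $M_2(R)$, respectively. Then \[ \operatorname{IN}(M_2(R))=\operatorname{NI}(M_2(R))=N(M_2(R))\cup\bigcup_{a,b\in R}\mathcal{O}_{M(a,b)} . \]
   Context: Rings are with identity; a principal ring is one in which every ideal is principal. $M_2(R)$ is the ring of $2\times 2$ matrices over $R$ and $GL_2(R)$ its group of invertible matrices. $N(M_2(R))$ is the set of all nilpotent matrices in $M_2(R)$. A matrix $A\in M_2(R)$ is an IN-matrix if $A=EN$ for some idempotent $E\in M_2(R)$ and some nilpotent $N\in M_2(R)$; it is an NI-matrix if $A=NE$ for some nilpotent $N\in M_2(R)$ and some idempotent $E\in M_2(R)$. For $a,b\in R$, $M(a,b)=\begin{pmatrix}a&b\\0&0\end{pmatrix}$. For $X\in M_2(R)$, $\mathcal{O}_X=\{PXP^{-1}: P\in GL_2(R)\}$ is the orbit of $X$ under conjugation by $GL_2(R)$. *)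

theory Defs
  imports "HOL-Analysis.Analysis" "HOL-Algebra.Algebraic_Closure_Type"
begin

definition local_ring :: "('a, 'b) ring_scheme \<Rightarrow> bool" where
  "local_ring R \<longleftrightarrow> cring R \<and> (\<exists>!M. maximalideal M R)"

definition principal_ring :: "('a, 'b) ring_scheme \<Rightarrow> bool" where
  "principal_ring R \<longleftrightarrow> ring R \<and> (\<forall>I. ideal I R \<longrightarrow> principalideal I R)"

text \<open>On \<^typ>\<open>'a^'n^'n\<close> the class operations \<open>*\<close>, \<open>^\<close> and \<open>1\<close> are componentwise, so the
  powers and the unit of the matrix ring have to be expressed with \<open>**\<close> and \<^term>\<open>mat 1\<close>.\<close>

primrec matrix_power :: "'a::semiring_1^'n^'n \<Rightarrow> nat \<Rightarrow> 'a^'n^'n" where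
  "matrix_power A 0 = mat 1"
| "matrix_power A (Suc k) = matrix_power A k ** A"

definition nilpotent_matrices :: "('a::semiring_1^'n^'n) set" where
  "nilpotent_matrices = {A. \<exists>k. matrix_power A k = 0}"

definition idempotent_matrices :: "('a::semiring_1^'n^'n) set" where
  "idempotent_matrices = {E. E ** E = E}"

definition IN_matrices :: "('a::semiring_1^'n^'n) set" where
  "IN_matrices = {E ** N | E N. E \<in> idempotent_matrices \<and> N \<in> nilpotent_matrices}"

definition NI_matrices :: "('a::semiring_1^'n^'n) set" where
  "NI_matrices = {N ** E | N E. N \<in> nilpotent_matrices \<and> E \<in> idempotent_matrices}"

definition conj_orbit :: "'a::semiring_1^'n^'n \<Rightarrow> ('a^'n^'n) set" where
  "conj_orbit A = {P ** A ** matrix_inv P | P. invertible P}"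

definition row_matrix :: "'a::zero \<Rightarrow> 'a \<Rightarrow> 'a^2^2" where
  "row_matrix a b = vector [vector [a, b], vector [0, 0]]"

end

theory Submission
  imports Defs
begin

text \<open>Over a local ring an idempotent of \<open>M\<^sub>2\<close> is \<open>0\<close>, \<open>1\<close> or a rank one projection \<open>v w\<^sup>T\<close> with
  \<open>w \<bullet> v = 1\<close>, so a product \<open>E N\<close> is nilpotent or of the form \<open>v u\<^sup>T\<close> with \<open>v\<close> unimodular; the
  latter matrices are exactly the conjugates of the row matrices. Conversely, divisibility is total in
  a local principal ring, so \<open>u = t u'\<close> with \<open>u'\<close> unimodular. For \<open>y = (-u'\<^sub>2, u'\<^sub>1)\<close> the matrix
  \<open>t y u'\<^sup>T\<close> squares to zero, and locality yields an idempotent \<open>v w\<^sup>T\<close> that maps \<open>y\<close> to \<open>v\<close> up to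
  a unit. The factorisation \<open>u = t u'\<close> also shows that this description is invariant under
  transposition, which exchanges the products \<open>E N\<close> and \<open>N E\<close>.\<close>

subsection \<open>Local principal rings\<close>

text \<open>Two nonunits would both lie in the unique maximal ideal, and then so would their sum
  1.\<close>

lemma local_ring_add_eq_one:
  fixes x y :: "'a::{comm_ring_1,finite}"
  assumes "local_ring (ring_of_type_algebra :: 'a ring)" and xy: "x + y = 1"
  shows "x dvd 1 \<or> y dvd 1"
proof (rule ccontr)
  define R where "R = (ring_of_type_algebra :: 'a ring)"
  have [simp]: "carrier R = UNIV" "a \<otimes>\<^bsub>R\<^esub> b = a * b" "\<one>\<^bsub>R\<^esub> = 1" "a \<oplus>\<^bsub>R\<^esub> b = a + b" for a b
    by (simp_all add: R_def ring_of_type_algebra_def)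
  interpret R: cring R
    unfolding R_def by (rule cring_from_type_algebra)
  have in_maximal: "\<exists>M. maximalideal M R \<and> a \<in> M" if "\<not> a dvd 1" for a
  proof -
    define S where "S = {I. ideal I R \<and> a \<in> I \<and> I \<noteq> UNIV}"
    have "1 \<notin> PIdl\<^bsub>R\<^esub> a"
      using that by (auto simp: cgenideal_def dvd_def mult.commute)
    moreover have "ideal (PIdl\<^bsub>R\<^esub> a) R" "a \<in> PIdl\<^bsub>R\<^esub> a"
      by (auto intro: R.cgenideal_ideal R.cgenideal_self)
    ultimately have "PIdl\<^bsub>R\<^esub> a \<in> S"
      unfolding S_def by auto
    \<comment> \<open>Finiteness of the ring makes \<open>S\<close> finite, so a maximal proper
      ideal containing \<open>a\<close> exists.\<close>
    then obtain M where M: "M \<in> S" and max: "\<And>J. J \<in> S \<Longrightarrow> M \<subseteq> J \<Longrightarrow> M = J"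
      using finite_has_maximal[of S] by auto
    have "maximalideal M R"
      using M max by (intro maximalidealI) (auto simp: S_def)
    then show ?thesis
      using M by (auto simp: S_def)
  qed
  assume nonunits: "\<not> (x dvd 1 \<or> y dvd 1)"
  obtain M where M: "maximalideal M R" "x \<in> M"
    using in_maximal[of x] nonunits by auto
  obtain M' where M': "maximalideal M' R" "y \<in> M'"
    using in_maximal[of y] nonunits by auto
  have "\<exists>!M. maximalideal M R"
    using assms(1) by (simp add: local_ring_def R_def)
  then have "M' = M"
    using M(1) M'(1) by (auto elim!: ex1E)
  then have "y \<in> M"
    using M'(2) by simp
  interpret M: maximalideal M R
    by fact
  have "x + y \<in> M"
    using M.a_closed[OF \<open>x \<in> M\<close> \<open>y \<in> M\<close>] by simp
  then have "M = UNIV"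
    using xy M.one_imp_carrier by simp
  then show False
    using M.I_notcarr by simp
qed

text \<open>Let \<open>d\<close> generate the ideal spanned by \<open>a\<close> and
  \<open>b\<close>. Unless \<open>d = 0\<close>, one of the two cofactors of \<open>d\<close> is a
  unit, so that element is associated to \<open>d\<close> and divides the other.\<close>

lemma local_principal_ring_dvd_total:
  fixes a b :: "'a::{comm_ring_1,finite}"
  assumes "local_ring (ring_of_type_algebra :: 'a ring)"
    and "principal_ring (ring_of_type_algebra :: 'a ring)"
  shows "a dvd b \<or> b dvd a"
proof -
  note local = local_ring_add_eq_one[OF assms(1)]
  define R where "R = (ring_of_type_algebra :: 'a ring)"
  have [simp]: "carrier R = UNIV" "r \<otimes>\<^bsub>R\<^esub> s = r * s" "r \<oplus>\<^bsub>R\<^esub> s = r + s" for r s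
    by (simp_all add: R_def ring_of_type_algebra_def)
  interpret R: cring R
    unfolding R_def by (rule cring_from_type_algebra)
  define I where "I = PIdl\<^bsub>R\<^esub> a <+>\<^bsub>R\<^esub> PIdl\<^bsub>R\<^esub> b"
  have I: "z \<in> I \<longleftrightarrow> (\<exists>x y. z = x * a + y * b)" for z
    by (auto simp: I_def set_add_def' cgenideal_def)
  have "ideal I R"
    unfolding I_def by (intro R.add_ideals R.cgenideal_ideal) auto
  then have "principalideal I R"
    using assms(2) by (simp add: principal_ring_def R_def)
  then obtain d where "I = PIdl\<^bsub>R\<^esub> d"
    using principalideal.generate[of I R] R.cgenideal_eq_genideal by auto
  then have d: "z \<in> I \<longleftrightarrow> d dvd z" for z
    by (auto simp: cgenideal_def dvd_def mult.commute)
  have "a \<in> I"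
    unfolding I by (intro exI[of _ 1] exI[of _ 0]) simp
  moreover have "b \<in> I"
    unfolding I by (intro exI[of _ 1] exI[of _ 0]) (simp add: I)
  ultimately obtain a' b' where ab: "a = d * a'" "b = d * b'"
    unfolding d dvd_def by blast
  obtain x y where xy: "d = x * a + y * b"
    using d[of d] I by auto
  define s where "s = x * a' + y * b'"
  \<comment> \<open>By locality \<open>1 - s\<close> or \<open>s\<close> is a unit: the former kills
    \<open>d\<close>, the latter makes the cofactors \<open>a'\<close> and \<open>b'\<close>
    generate the unit ideal.\<close>
  have ds: "d * (1 - s) = 0"
    using xy unfolding ab s_def by (simp add: algebra_simps)
  consider "(1 - s) dvd 1" | "s dvd 1"
    using local[of s "1 - s"] by auto
  then show ?thesis
  proof cases
    case 1
    then obtain k where "(1 - s) * k = 1"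
      by (metis dvd_def)
    then have "d = 0"
      using ds by (metis mult.assoc mult_1_right mult_zero_left)
    then show ?thesis
      by (simp add: ab)
  next
    case 2
    then obtain k where "s * k = 1"
      by (metis dvd_def)
    then have "(k * x) * a' + (k * y) * b' = 1"
      by (simp add: s_def algebra_simps)
    then have "a' dvd 1 \<or> b' dvd 1"
      using local dvd_mult_right by blast
    moreover have "d * r dvd d * r'" if "r dvd 1" for r r'
      using that by (intro mult_dvd_mono) (auto intro: dvd_trans)
    ultimately show ?thesis
      unfolding ab by blast
  qed
qed

subsection \<open>Matrices of the form \<open>v w\<^sup>T\<close>\<close>

definition dot :: "'a::comm_ring_1^'n \<Rightarrow> 'a^'n \<Rightarrow> 'a" where
  "dot v w = (\<Sum>i\<in>UNIV. v$i * w$i)"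

definition outer :: "'a::comm_ring_1^'n \<Rightarrow> 'a^'m \<Rightarrow> 'a^'m^'n" where
  "outer v w = (\<chi> i j. v$i * w$j)"

lemma dot_add_left: "dot (v + v') w = dot v w + dot v' w"
  by (simp add: dot_def algebra_simps sum.distrib)

lemma dot_scale_left: "dot (c *s v) w = c * dot v w"
  by (simp add: dot_def algebra_simps sum_distrib_left)

lemma dot_scale_right: "dot v (c *s w) = c * dot v w"
  by (simp add: dot_def algebra_simps sum_distrib_left)

lemma dot_2: "dot v (w :: 'a::comm_ring_1^2) = v$1 * w$1 + v$2 * w$2"
  by (simp add: dot_def sum_2)

lemma outer_scale: "outer (c *s v) w = outer v (c *s w)"
  by (simp add: outer_def vec_eq_iff algebra_simps)

lemma transpose_outer: "transpose (outer v w) = outer w v"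
  by (simp add: outer_def transpose_def vec_eq_iff mult.commute)

lemma matrix_mul_outer: "A ** outer v w = outer (A *v v) w"
  by (simp add: outer_def matrix_matrix_mult_def matrix_vector_mult_def vec_eq_iff
      sum_distrib_right mult.assoc)

lemma outer_mul_matrix: "outer v w ** A = outer v (transpose A *v w)"
  by (simp add: outer_def matrix_matrix_mult_def matrix_vector_mult_def transpose_def vec_eq_iff
      sum_distrib_left algebra_simps)

lemma outer_mul_vector: "outer v w *v x = dot w x *s v"
  by (simp add: outer_def matrix_vector_mult_def dot_def vec_eq_iff sum_distrib_left ac_simps)

lemma outer_mul_outer: "outer v w ** outer x y = outer (dot w x *s v) y"
  by (simp add: matrix_mul_outer outer_mul_vector)

lemma dot_transpose_mul: "dot (transpose A *v v) w = dot v (A *v w)"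
proof -
  have "dot (transpose A *v v) w = (\<Sum>i\<in>UNIV. \<Sum>j\<in>UNIV. A$j$i * v$j * w$i)"
    by (simp add: dot_def matrix_vector_mult_def transpose_def sum_distrib_right)
  also have "\<dots> = (\<Sum>j\<in>UNIV. \<Sum>i\<in>UNIV. A$j$i * v$j * w$i)"
    by (rule sum.swap)
  also have "\<dots> = dot v (A *v w)"
    by (simp add: dot_def matrix_vector_mult_def sum_distrib_left algebra_simps)
  finally show ?thesis .
qed

lemma zero_in_nilpotent_matrices: "0 \<in> nilpotent_matrices"
  by (auto simp: nilpotent_matrices_def intro!: exI[of _ "Suc 0"])

lemma outer_in_idempotent_matrices: "dot w v = 1 \<Longrightarrow> outer v w \<in> idempotent_matrices"
  by (simp add: idempotent_matrices_def outer_mul_outer)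

lemma outer_in_nilpotent_matrices: "dot w v = 0 \<Longrightarrow> outer v w \<in> nilpotent_matrices"
proof -
  assume "dot w v = 0"
  then have "matrix_power (outer v w) (Suc (Suc 0)) = 0"
    by (simp add: outer_mul_outer) (simp add: outer_def vec_eq_iff)
  then show ?thesis
    unfolding nilpotent_matrices_def by blast
qed

text \<open>The determinant \<open>D\<close> is idempotent, hence 0 or 1; if \<open>D = 0\<close>,
  so is the trace \<open>t\<close>. \<open>D = 1\<close> forces the identity, \<open>t = 0\<close>
  the zero matrix and \<open>t = 1\<close> a rank one projection.\<close>

lemma idempotent_matrix_2_cases:
  fixes E :: "'a::comm_ring_1^2^2"
  assumes local: "\<And>x y :: 'a. x + y = 1 \<Longrightarrow> x dvd 1 \<or> y dvd 1"
    and "E \<in> idempotent_matrices"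
  obtains "E = 0" | "E = mat 1" | v w where "dot w v = 1" "E = outer v w"
proof -
  have idem: "c = 0 \<or> c = 1" if "c * c = c" for c :: 'a
  proof -
    consider k where "k * c = 1" | k where "k * (1 - c) = 1"
      using local[of c "1 - c"] by (auto simp: dvd_def mult.commute)
    then show ?thesis
    proof cases
      case 1
      have "c = k * c * c"
        using 1 by simp
      also have "\<dots> = k * c"
        unfolding mult.assoc that ..
      finally show ?thesis
        using 1 by simp
    next
      case 2
      have "c = k * (1 - c) * c"
        using 2 by simp
      also have "\<dots> = 0"
        by (simp add: mult.assoc left_diff_distrib that)
      finally show ?thesis
        by simp
    qed
  qed
  define p q r s where "p = E$1$1" and "q = E$1$2" and "r = E$2$1" and "s = E$2$2"
  note E_defs = p_def[symmetric] q_def[symmetric] r_def[symmetric] s_def[symmetric]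
  have "E ** E = E"
    using assms(2) by (simp add: idempotent_matrices_def)
  then have E: "p * p + q * r = p" "p * q + q * s = q" "r * p + s * r = r" "r * q + s * s = s"
    by (simp_all add: vec_eq_iff matrix_matrix_mult_def forall_2 sum_2 E_defs)
  define D where "D = p * s - q * r"
  \<comment> \<open>Multiplicativity of the determinant, written out for
    \<open>E ** E\<close>.\<close>
  have "D * D = (p * p + q * r) * (r * q + s * s) - (p * q + q * s) * (r * p + s * r)"
    unfolding D_def by (simp add: algebra_simps)
  also have "\<dots> = D"
    unfolding E D_def ..
  finally consider "D = 0" | "D = 1"
    using idem by blast
  then show ?thesis
  proof cases
    case 1
    define t where "t = p + s"
    \<comment> \<open>Cayley-Hamilton with determinant zero: \<open>E ** E\<close> is
      \<open>t\<close> times \<open>E\<close>.\<close>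
    have t: "p * t = p" "q * t = q" "r * t = r" "s * t = s"
      using E 1 unfolding D_def t_def by (simp_all add: algebra_simps)
    then have "t * t = t"
      by (metis distrib_right t_def)
    then consider "t = 0" | "t = 1"
      using idem by blast
    then show ?thesis
    proof cases
      case 1
      then have "E = 0"
        using t by (simp add: vec_eq_iff forall_2 E_defs)
      then show ?thesis
        by (rule that)
    next
      case 2
      have qr: "q * r = p * s"
        using \<open>D = 0\<close> by (simp add: D_def)
      consider k where "p * k = 1" | k where "s * k = 1"
        using local[of p s] 2 by (auto simp: t_def dvd_def)
      then show ?thesis
      proof cases
        case 1
        \<comment> \<open>The first column, and the first row divided by its unit entry
          \<open>p\<close>; the determinant being zero recovers \<open>s\<close>.\<close>
        define v w :: "'a^2" where "v = vector [p, r]" and "w = vector [1, q * k]"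
        have "q * k * r = s"
          using qr 1 by (metis mult.assoc mult.commute mult_1_left)
        moreover have "p * (q * k) = q"
          using 1 by (metis mult.left_commute mult_1_right)
        ultimately have "dot w v = 1" "E = outer v w"
          using 2 by (simp_all add: dot_2 v_def w_def outer_def vec_eq_iff forall_2 E_defs t_def
              mult.commute)
        then show ?thesis
          by (rule that)
      next
        case 2
        define v w :: "'a^2" where "v = vector [q, s]" and "w = vector [r * k, 1]"
        have "r * k * q = p"
          using qr 2 by (metis mult.assoc mult.commute mult_1_left)
        moreover have "s * (r * k) = r"
          using 2 by (metis mult.left_commute mult_1_right)
        ultimately have "dot w v = 1" "E = outer v w"
          using \<open>t = 1\<close> by (simp_all add: dot_2 v_def w_def outer_def vec_eq_iff forall_2 E_defs t_def
              mult.commute)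
        then show ?thesis
          by (rule that)
      qed
    qed
  next
    case 2
    have D: "p * s - q * r = 1"
      using 2 by (simp add: D_def)
    \<comment> \<open>This makes \<open>p + s - 1\<close> a unit, and it annihilates both
      off-diagonal entries.\<close>
    have unit: "(p + s - 1) * p = 1"
      using E(1) D by (simp add: algebra_simps)
    moreover have "q * (p + s - 1) = 0" "r * (p + s - 1) = 0"
      using E(2,3) by (simp_all add: algebra_simps)
    ultimately have "q = 0" "r = 0"
      by (metis mult.assoc mult_1_right mult_zero_left)+
    then have "p * p = p" "s * s = s" "p * s = 1"
      using E(1,4) D by simp_all
    then have "p = 1" "s = 1"
      by (metis mult.assoc mult_1_right mult_1_left)+
    then have "E = mat 1"
      using \<open>q = 0\<close> \<open>r = 0\<close>
      by (simp add: vec_eq_iff forall_2 mat_def E_defs)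
    then show ?thesis
      by (rule that)
  qed
qed

subsection \<open>Orbits of row matrices\<close>

text \<open>The witness \<open>w\<close> certifies that the column \<open>v\<close> is unimodular;
  the row \<open>u\<close> is arbitrary.\<close>

definition unimodular_outers :: "('a::comm_ring_1^'n^'n) set" where
  "unimodular_outers = {outer v u | v u. \<exists>w. dot w v = 1}"

lemma row_matrix_eq_outer: "row_matrix a b = outer (axis 1 1) (vector [a, b])"
  by (simp add: row_matrix_def outer_def vec_eq_iff forall_2 axis_def)

lemma matrix_inv_mul:
  assumes "invertible A"
  shows "matrix_inv A ** A = mat 1"
  using someI_ex[OF assms[unfolded invertible_def]] by (simp add: matrix_inv_def)

lemma matrix_inv_unique:
  assumes "A ** B = mat 1" "B ** A = mat 1"
  shows "matrix_inv A = B"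
proof -
  have "matrix_inv A ** A = mat 1"
    using assms by (intro matrix_inv_mul) (auto simp: invertible_def)
  then show ?thesis
    using assms by (metis matrix_mul_assoc matrix_mul_lid matrix_mul_rid)
qed

text \<open>Conjugation by \<open>P\<close> turns the column \<open>axis 1 1\<close> into the first
  column of \<open>P\<close>, and the unimodular vectors of length two are exactly such
  columns.\<close>

lemma conj_orbit_row_matrix_union:
  "(\<Union>a. \<Union>b. conj_orbit (row_matrix a b)) = (unimodular_outers :: ('a::comm_ring_1^2^2) set)"
proof (intro equalityI subsetI)
  fix A :: "'a^2^2"
  assume "A \<in> (\<Union>a. \<Union>b. conj_orbit (row_matrix a b))"
  then obtain a b and P :: "'a^2^2" where P: "invertible P"
    and A: "A = P ** row_matrix a b ** matrix_inv P"
    by (auto simp: conj_orbit_def)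
  \<comment> \<open>The certificate is the first row of the inverse of \<open>P\<close>.\<close>
  have "dot (transpose (matrix_inv P) *v axis 1 1) (P *v axis 1 1) = 1"
    unfolding dot_transpose_mul matrix_vector_mul_assoc matrix_inv_mul[OF P]
    by (simp add: dot_2 axis_def)
  then show "A \<in> unimodular_outers"
    unfolding A row_matrix_eq_outer matrix_mul_outer outer_mul_matrix unimodular_outers_def by blast
next
  fix A :: "'a^2^2"
  assume "A \<in> unimodular_outers"
  then obtain v u w where A: "A = outer v u" and wv: "dot w v = 1"
    by (auto simp: unimodular_outers_def)
  \<comment> \<open>\<open>P\<close> completes \<open>v\<close> to a matrix of determinant
    \<open>dot w v = 1\<close>, and \<open>Q\<close> is its adjugate.\<close>
  define P Q :: "'a^2^2" where "P = vector [vector [v$1, - w$2], vector [v$2, w$1]]"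
    and "Q = vector [vector [w$1, w$2], vector [- v$2, v$1]]"
  have wv': "w$1 * v$1 + w$2 * v$2 = 1"
    using wv by (simp add: dot_2)
  have PQ: "P ** Q = mat 1" "Q ** P = mat 1"
    using wv' by (simp_all add: P_def Q_def vec_eq_iff forall_2 matrix_matrix_mult_def sum_2 mat_def
        algebra_simps)
  define x where "x = transpose P *v u"
  have "P *v axis 1 1 = v"
    by (simp add: P_def vec_eq_iff forall_2 matrix_vector_mult_def sum_2 axis_def)
  moreover have "vector [x$1, x$2] = x"
    by (simp add: vec_eq_iff forall_2)
  moreover have "transpose Q *v x = u"
    unfolding x_def matrix_vector_mul_assoc matrix_transpose_mul[symmetric] PQ
    by (simp del: transpose_matrix_vector)
  ultimately have "A = P ** row_matrix (x$1) (x$2) ** matrix_inv P"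
    by (simp add: A row_matrix_eq_outer matrix_mul_outer outer_mul_matrix matrix_inv_unique[OF PQ])
  moreover have "invertible P"
    using PQ by (auto simp: invertible_def)
  ultimately show "A \<in> (\<Union>a. \<Union>b. conj_orbit (row_matrix a b))"
    by (auto simp: conj_orbit_def)
qed

text \<open>Factoring out the coordinate that divides the other leaves an entry 1 in
  \<open>u'\<close>.\<close>

lemma scaled_unimodular:
  fixes u :: "'a::comm_ring_1^2"
  assumes "\<And>a b :: 'a. a dvd b \<or> b dvd a"
  obtains t u' z where "u = t *s u'" "dot z u' = 1"
proof -
  consider d where "u$2 = u$1 * d" | d where "u$1 = u$2 * d"
    using assms[of "u$1" "u$2"] by (auto simp: dvd_def)
  then show ?thesis
  proof cases
    case 1
    show ?thesis
      by (rule that[of "u$1" "vector [1, d]" "axis 1 1"])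
        (auto simp: vec_eq_iff forall_2 dot_2 axis_def 1)
  next
    case 2
    show ?thesis
      by (rule that[of "u$2" "vector [d, 1]" "axis 2 1"])
        (auto simp: vec_eq_iff forall_2 dot_2 axis_def 2)
  qed
qed

text \<open>The scalar \<open>t\<close> of \<open>u = t *s u'\<close> moves over to
  \<open>v\<close>, which leaves the unimodular \<open>u'\<close> as the new column.\<close>

lemma transpose_unimodular_outers:
  fixes A :: "'a::comm_ring_1^2^2"
  assumes "\<And>a b :: 'a. a dvd b \<or> b dvd a" and "A \<in> unimodular_outers"
  shows "transpose A \<in> unimodular_outers"
proof -
  obtain v u where A: "A = outer v u"
    using assms(2) by (auto simp: unimodular_outers_def)
  obtain t u' z where "u = t *s u'" "dot z u' = 1"
    using scaled_unimodular[OF assms(1)] .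
  then show ?thesis
    by (auto simp: A transpose_outer outer_scale unimodular_outers_def)
qed

subsection \<open>Products of idempotents and nilpotents\<close>

lemma matrix_power_Suc_left: "matrix_power A (Suc k) = A ** matrix_power A k"
  by (induction k) (simp_all flip: matrix_mul_assoc)

lemma matrix_power_transpose:
  fixes A :: "'a::comm_ring_1^'n^'n"
  shows "matrix_power (transpose A) k = transpose (matrix_power A k)"
proof (induction k)
  case (Suc k)
  then show ?case
    by (metis matrix_power.simps(2) matrix_power_Suc_left matrix_transpose_mul)
qed simp

lemma transpose_nilpotent_matrices:
  fixes A :: "'a::comm_ring_1^'n^'n"
  assumes "A \<in> nilpotent_matrices"
  shows "transpose A \<in> nilpotent_matrices"
proof -
  obtain k where "matrix_power A k = 0"
    using assms by (auto simp: nilpotent_matrices_def)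
  then have "matrix_power (transpose A) k = 0"
    by (simp add: matrix_power_transpose) (simp add: transpose_def vec_eq_iff)
  then show ?thesis
    by (auto simp: nilpotent_matrices_def)
qed

lemma transpose_idempotent_matrices:
  fixes A :: "'a::comm_ring_1^'n^'n"
  shows "A \<in> idempotent_matrices \<Longrightarrow> transpose A \<in> idempotent_matrices"
  by (simp add: idempotent_matrices_def flip: matrix_transpose_mul)

lemma NI_matrices_iff_transpose:
  fixes A :: "'a::comm_ring_1^'n^'n"
  shows "A \<in> NI_matrices \<longleftrightarrow> transpose A \<in> IN_matrices"
proof
  assume "A \<in> NI_matrices"
  then show "transpose A \<in> IN_matrices"
    unfolding IN_matrices_def NI_matrices_def
    by (force simp: matrix_transpose_mul intro: transpose_nilpotent_matrices
        transpose_idempotent_matrices)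
next
  assume "transpose A \<in> IN_matrices"
  then obtain E N where "E \<in> idempotent_matrices" "N \<in> nilpotent_matrices" "transpose A = E ** N"
    by (auto simp: IN_matrices_def)
  moreover from this have "A = transpose N ** transpose E"
    by (metis matrix_transpose_mul transpose_transpose)
  ultimately show "A \<in> NI_matrices"
    unfolding NI_matrices_def
    using transpose_nilpotent_matrices transpose_idempotent_matrices by blast
qed

text \<open>Two hyperplanes never cover the residue plane, so one linear form takes unit values at both
  vectors.\<close>
lemma common_dual_vector:
  fixes v y :: "'a::comm_ring_1^'n"
  assumes local: "\<And>a b :: 'a. a + b = 1 \<Longrightarrow> a dvd 1 \<or> b dvd 1"
    and "dot v' v = 1" "dot y' y = 1"
  obtains w c where "dot w v = 1" "dot w (c *s y) = 1"
proof -
  have "\<exists>w. dot w v dvd 1 \<and> dot w y dvd 1"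
  proof (cases "dot v' y dvd 1 \<or> dot y' v dvd 1")
    case True
    then show ?thesis
      using assms(2,3) by (metis dvd_refl)
  next
    case False
    \<comment> \<open>If neither \<open>v'\<close> nor \<open>y'\<close> serves both vectors, their
      sum does: each value is 1 plus a nonunit.\<close>
    have "1 + a dvd 1" "a + 1 dvd 1" if "\<not> a dvd 1" for a :: 'a
      using local[of "1 + a" "- a"] local[of "a + 1" "- a"] that by simp_all
    then have "dot (v' + y') v dvd 1" "dot (v' + y') y dvd 1"
      using assms(2,3) False by (simp_all add: dot_add_left)
    then show ?thesis
      by blast
  qed
  then obtain w k l where kl: "1 = dot w v * k" "1 = dot w y * l"
    by (auto simp: dvd_def)
  \<comment> \<open>Scaling \<open>w\<close> by \<open>k\<close> normalises its value at
    \<open>v\<close>; the factor \<open>dot w v\<close> in the scalar of \<open>y\<close> cancels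
    that \<open>k\<close>.\<close>
  have "dot (k *s w) ((dot w v * l) *s y) = (dot w v * k) * (dot w y * l)"
    by (simp add: dot_scale_left dot_scale_right algebra_simps)
  then have "dot (k *s w) v = 1" "dot (k *s w) ((dot w v * l) *s y) = 1"
    using kl by (simp_all add: dot_scale_left mult.commute)
  then show ?thesis
    by (rule that)
qed

lemma IN_matrices_2_eq:
  assumes local: "\<And>a b :: 'a::comm_ring_1. a + b = 1 \<Longrightarrow> a dvd 1 \<or> b dvd 1"
    and total: "\<And>a b :: 'a. a dvd b \<or> b dvd a"
  shows "(IN_matrices :: ('a^2^2) set) = nilpotent_matrices \<union> unimodular_outers"
proof (intro equalityI subsetI)
  fix A :: "'a^2^2"
  assume "A \<in> IN_matrices"
  then obtain E N where E: "E \<in> idempotent_matrices" and N: "N \<in> nilpotent_matrices"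
    and A: "A = E ** N"
    by (auto simp: IN_matrices_def)
  show "A \<in> nilpotent_matrices \<union> unimodular_outers"
  proof (rule idempotent_matrix_2_cases[OF local E])
    assume "E = 0"
    then show ?thesis
      by (simp add: A zero_in_nilpotent_matrices)
  next
    assume "E = mat 1"
    then show ?thesis
      using N by (simp add: A)
  next
    fix v w
    assume "dot w v = 1" "E = outer v w"
    then show ?thesis
      by (auto simp: A outer_mul_matrix unimodular_outers_def)
  qed
next
  fix A :: "'a^2^2"
  assume "A \<in> nilpotent_matrices \<union> unimodular_outers"
  then show "A \<in> IN_matrices"
  proof
    assume "A \<in> nilpotent_matrices"
    moreover have "mat 1 \<in> idempotent_matrices"
      by (simp add: idempotent_matrices_def)
    ultimately show ?thesis
      unfolding IN_matrices_def by (metis (mono_tags, lifting) matrix_mul_lid mem_Collect_eq)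
  next
    assume "A \<in> unimodular_outers"
    then obtain v u v' where A: "A = outer v u" and v': "dot v' v = 1"
      by (auto simp: unimodular_outers_def)
    obtain t u' z where u: "u = t *s u'" and z: "dot z u' = 1"
      using scaled_unimodular[OF total] .
    \<comment> \<open>Quarter turns of \<open>u'\<close> and \<open>z\<close>: \<open>y\<close> is
      orthogonal to \<open>u'\<close>, and \<open>dot y' y\<close> equals
      \<open>dot z u'\<close>.\<close>
    define y y' :: "'a^2" where "y = vector [- u'$2, u'$1]" and "y' = vector [- z$2, z$1]"
    have "dot y' y = 1"
      using z by (simp add: y_def y'_def dot_2 add.commute)
    then obtain w c where w: "dot w v = 1" "dot w (c *s y) = 1"
      using common_dual_vector[OF local v'] by blast
    have "dot u (c *s y) = 0"
      by (simp add: u dot_scale_left dot_scale_right) (simp add: y_def dot_2)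
    then have "outer (c *s y) u \<in> nilpotent_matrices"
      by (rule outer_in_nilpotent_matrices)
    \<comment> \<open>The inner factor of this product is \<open>dot w (c *s y) = 1\<close>.\<close>
    moreover have "A = outer v w ** outer (c *s y) u"
      by (simp add: outer_mul_outer w A)
    ultimately show ?thesis
      unfolding IN_matrices_def using outer_in_idempotent_matrices[OF w(1)] by blast
  qed
qed

theorem theorem3p6:
  assumes "local_ring (ring_of_type_algebra :: 'a::{comm_ring_1,finite} ring)"
    and "principal_ring (ring_of_type_algebra :: 'a ring)"
  shows "(IN_matrices :: ('a^2^2) set) = NI_matrices
    \<and> (NI_matrices :: ('a^2^2) set)
        = nilpotent_matrices \<union> (\<Union>a. \<Union>b. conj_orbit (row_matrix a b))"
proof -
  note total = local_principal_ring_dvd_total[OF assms]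
  note IN = IN_matrices_2_eq[OF local_ring_add_eq_one[OF assms(1)] total]
  have transpose: "transpose A \<in> IN_matrices" if "A \<in> IN_matrices" for A :: "'a^2^2"
    using that transpose_nilpotent_matrices transpose_unimodular_outers[OF total] by (auto simp: IN)
  \<comment> \<open>Closure of \<open>IN_matrices\<close> under transposition is applied to
    \<open>A\<close> and to its transpose, one for each direction.\<close>
  have "A \<in> NI_matrices \<longleftrightarrow> A \<in> IN_matrices" for A :: "'a^2^2"
    using transpose[of A] transpose[of "transpose A"] by (auto simp: NI_matrices_iff_transpose)
  then have "(NI_matrices :: ('a^2^2) set) = IN_matrices"
    by blast
  then show ?thesis
    by (simp add: IN conj_orbit_row_matrix_union)
qed

end
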